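(* Let $s\geq0$ and let $(F,d)$ be a non-empty compact $s$-Ahlfors--David regular metric space, with any choice of abstract rationals $P=(P(q))_{q\in\mathbb{N}}$ in $F$. Then for all $t\geq1$ $$\frac{s}{t}\leq\dim_{\mathrm H}F_t\leq\frac{s+1}{t}.$$
   Context: For a non-empty totally bounded metric space $(F,d)$, a set $A\subseteq F$ is $r$-separated if $d(a,b)\geq r$ for all distinct $a,b\in A$. A choice of abstract rationals in $F$ is a family $P=(P(q))_{q\in\mathbb{N}}$, $\mathbb N=\{1,2,\dots\}$, where each $P(q)\subseteq F$ is a maximal $(1/q)$-separated set, i.e. it is $(1/q)$-separated and no further point of $F$ can be added while keeping it $(1/q)$-separated. Given such a choice and $t>0$, $$F_t=\bigcap_{N}\bigcup_{q>N}\bigcup_{p\in P(q)}B(p,1/q^t),$$ where $B(x,r)$ denotes the closed ball in $F$; that is, $F_t$ is the set of $x\in F$ such that for infinitely many $q$ there is $p\in P(q)$ with $d(p,x)\leq 1/q^t$. $\mathcal{H}^s$ denotes $s$-dimensional Hausdorff measure and $\dim_{\mathrm H}$ Hausdorff dimension. A compact metric space $F$ is $s$-Ahlfors--David regular ($s\geq0$) if there is a constant $C>0$ such that $r^s/C\leq\mathcal{H}^s(B(x,r))\leq Cr^s$ for all $0<r<1$ and all $x\in F$. *)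

theory Defs
  imports "HOL-Analysis.Analysis"
begin

text \<open>A metric space \<open>(F, d)\<close> is represented by a set \<open>F\<close> in a type of class
  \<^class>\<open>metric_space\<close> with the inherited metric; its closed balls are \<open>cball x r \<inter> F\<close>.\<close>

text \<open>The quantity \<open>(diam U)\<^sup>s\<close>, with the usual conventions that the empty set contributes \<open>0\<close> and
  that \<open>0\<^sup>0 = 1\<close>, so that the \<open>0\<close>-dimensional measure counts points.
  The case \<open>s = 0\<close> is separate because \<open>0 powr 0 = 0\<close>.\<close>

definition diam_weight :: "real \<Rightarrow> 'a::metric_space set \<Rightarrow> ennreal" where
  "diam_weight s U =
     (if U = {} then 0 else if s = 0 then 1 else ennreal (diameter U powr s))"

text \<open>Boundedness is required explicitly because \<^const>\<open>diameter\<close> is unspecified on unbounded sets.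
  Finite covers are included, by padding with empty sets.\<close>

definition delta_covers :: "real \<Rightarrow> 'a::metric_space set \<Rightarrow> (nat \<Rightarrow> 'a set) set" where
  "delta_covers \<delta> A =
     {U. A \<subseteq> (\<Union>i. U i) \<and> (\<forall>i. bounded (U i) \<and> diameter (U i) \<le> \<delta>)}"

definition hausdorff_premeasure :: "real \<Rightarrow> real \<Rightarrow> 'a::metric_space set \<Rightarrow> ennreal" where
  "hausdorff_premeasure s \<delta> A = (INF U\<in>delta_covers \<delta> A. \<Sum>i. diam_weight s (U i))"

definition hausdorff_measure :: "real \<Rightarrow> 'a::metric_space set \<Rightarrow> ennreal" where
  "hausdorff_measure s A = (SUP \<delta>\<in>{0<..}. hausdorff_premeasure s \<delta> A)"

definition hausdorff_dim :: "'a::metric_space set \<Rightarrow> ereal" where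
  "hausdorff_dim A = Inf {ereal s | s. 0 \<le> s \<and> hausdorff_measure s A = 0}"

definition ahlfors_david_regular :: "real \<Rightarrow> 'a::metric_space set \<Rightarrow> bool" where
  "ahlfors_david_regular s F \<longleftrightarrow>
     (\<exists>C>0. \<forall>r x. 0 < r \<and> r < 1 \<and> x \<in> F \<longrightarrow>
        ennreal (r powr s / C) \<le> hausdorff_measure s (cball x r \<inter> F) \<and>
        hausdorff_measure s (cball x r \<inter> F) \<le> ennreal (C * r powr s))"

definition r_separated :: "real \<Rightarrow> 'a::metric_space set \<Rightarrow> bool" where
  "r_separated r A \<longleftrightarrow> (\<forall>a\<in>A. \<forall>b\<in>A. a \<noteq> b \<longrightarrow> r \<le> dist a b)"

definition maximal_separated :: "'a::metric_space set \<Rightarrow> real \<Rightarrow> 'a set \<Rightarrow> bool" where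
  "maximal_separated F r A \<longleftrightarrow>
     A \<subseteq> F \<and> r_separated r A \<and> (\<forall>x\<in>F - A. \<not> r_separated r (insert x A))"

text \<open>The index \<open>q\<close> ranges over the positive integers; \<open>P 0\<close> is irrelevant here and in the
  limsup set below.\<close>

definition abstract_rationals :: "'a::metric_space set \<Rightarrow> (nat \<Rightarrow> 'a set) \<Rightarrow> bool" where
  "abstract_rationals F P \<longleftrightarrow> (\<forall>q\<ge>1. maximal_separated F (1 / real q) (P q))"

definition well_approximable :: "'a::metric_space set \<Rightarrow> (nat \<Rightarrow> 'a set) \<Rightarrow> real \<Rightarrow> 'a set" where
  "well_approximable F P t =
     (\<Inter>N. \<Union>q\<in>{N<..}. \<Union>p\<in>P q. cball p (1 / real q powr t) \<inter> F)"

end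

theory Submission
  imports Defs
begin

text \<open>
  Regularity gives that a \<open>1/q\<close>-separated set has at most \<open>K q\<^sup>s\<close> points, so that the natural cover of
  the limsup set by the balls \<open>B(p, q\<^sup>-\<^sup>t)\<close> yields the upper bound.

  For the lower bound let \<open>u < s/t\<close> and suppose that sets \<open>U\<^sub>i\<close> of diameter at most \<open>d\<^sub>i\<close>, with
  \<open>\<Sum> d\<^sub>i\<^sup>u\<close> small, cover the limsup set. Call the sum of \<open>d\<^sub>i\<^sup>u\<close> over those \<open>U\<^sub>i\<close> that meet a ball
  its hit weight. If a ball of radius \<open>r\<close> has hit weight at most \<open>(l r)\<^sup>u\<close>, then for large \<open>q\<close> it
  contains a ball of radius \<open>\<rho> = q\<^sup>-\<^sup>t/4\<close> about some \<open>p \<in> P(q)\<close> with hit weight at most \<open>(l \<rho>)\<^sup>u\<close>: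
  the sets with \<open>d\<^sub>i \<ge> 1/(2q)\<close> meet at most half of the roughly \<open>(q r)\<^sup>s\<close> candidate balls, each of the
  other sets meets at most one of them, and \<open>(q r)\<^sup>s \<rho>\<^sup>u\<close> is large compared with \<open>r\<^sup>u\<close> because
  \<open>t u < s\<close>. Iterating, the nested balls shrink to a point of the limsup set, which lies in no \<open>U\<^sub>i\<close>
  because every \<open>d\<^sub>i\<close> is positive while the hit weights tend to \<open>0\<close>. This replaces the
  construction of a mass distribution on a Cantor subset.
\<close>

subsection \<open>Hausdorff measure\<close>

lemma diameter_le_dist:
  fixes S :: "'a::metric_space set"
  assumes "0 \<le> \<delta>" and "\<And>x y. x \<in> S \<Longrightarrow> y \<in> S \<Longrightarrow> dist x y \<le> \<delta>"
  shows "diameter S \<le> \<delta>"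
  using assms by (auto simp: diameter_def intro: cSUP_least)

lemma delta_coversD:
  assumes "U \<in> delta_covers \<delta> A"
  shows "A \<subseteq> (\<Union>i. U i)" and "bounded (U i)" and "diameter (U i) \<le> \<delta>"
  using assms by (auto simp: delta_covers_def)

lemma hausdorff_premeasure_le:
  "U \<in> delta_covers \<delta> A \<Longrightarrow> hausdorff_premeasure s \<delta> A \<le> (\<Sum>i. diam_weight s (U i))"
  by (auto simp: hausdorff_premeasure_def intro: INF_lower)

lemma hausdorff_premeasure_mono:
  "A \<subseteq> B \<Longrightarrow> hausdorff_premeasure s \<delta> A \<le> hausdorff_premeasure s \<delta> B"
  by (auto simp: hausdorff_premeasure_def delta_covers_def intro!: INF_superset_mono)

lemma hausdorff_premeasure_antimono:
  "\<delta> \<le> \<epsilon> \<Longrightarrow> hausdorff_premeasure s \<epsilon> A \<le> hausdorff_premeasure s \<delta> A"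
  unfolding hausdorff_premeasure_def delta_covers_def
  by (rule INF_superset_mono) (auto intro: order_trans)

lemma hausdorff_premeasure_approx:
  assumes "hausdorff_premeasure s \<delta> A < c"
  obtains U where "U \<in> delta_covers \<delta> A" and "(\<Sum>i. diam_weight s (U i)) < c"
  using assms by (auto simp: hausdorff_premeasure_def INF_less_iff)

lemma hausdorff_premeasure_le_diam_weight:
  assumes "bounded U" and "diameter U \<le> \<delta>" and "0 \<le> \<delta>"
  shows "hausdorff_premeasure s \<delta> U \<le> diam_weight s U"
proof -
  have "(\<lambda>i::nat. if i = 0 then U else {}) \<in> delta_covers \<delta> U"
    using assms by (auto simp: delta_covers_def)
  then have "hausdorff_premeasure s \<delta> U \<le> (\<Sum>i::nat. diam_weight s (if i = 0 then U else {}))"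
    by (rule hausdorff_premeasure_le)
  also have "\<dots> = (\<Sum>i\<in>{0::nat}. diam_weight s (if i = 0 then U else {}))"
    by (rule suminf_finite) (auto simp: diam_weight_def)
  finally show ?thesis by simp
qed

lemma hausdorff_premeasure_empty [simp]: "0 \<le> \<delta> \<Longrightarrow> hausdorff_premeasure s \<delta> {} = 0"
  using hausdorff_premeasure_le_diam_weight[of "{}" \<delta> s] by (simp add: diam_weight_def)

text \<open>Covers of the \<open>A i\<close>, each within \<open>e / 2 ^ Suc i\<close> of optimal,
  are merged into one cover along the pairing bijection of the naturals.\<close>

lemma hausdorff_premeasure_countable_subadditive:
  "hausdorff_premeasure s \<delta> (\<Union>i. A i) \<le> (\<Sum>i. hausdorff_premeasure s \<delta> (A i))"
proof (rule ennreal_le_epsilon)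
  fix e :: real
  assume fin: "(\<Sum>i. hausdorff_premeasure s \<delta> (A i)) < top" and e: "0 < e"
  define b where "b i = e * (1 / 2) ^ Suc i" for i :: nat
  have b: "b i > 0" for i using e by (simp add: b_def)
  \<comment> \<open>Finiteness makes the excess \<open>b i\<close> a strict one, as is needed to
    extract a cover from the infimum.\<close>
  have "hausdorff_premeasure s \<delta> (A i) < top" for i
  proof -
    have "(\<Sum>i\<in>{i}. hausdorff_premeasure s \<delta> (A i)) \<le> (\<Sum>i. hausdorff_premeasure s \<delta> (A i))"
      by (rule sum_le_suminf) auto
    then show ?thesis using fin by simp
  qed
  then have "hausdorff_premeasure s \<delta> (A i) < hausdorff_premeasure s \<delta> (A i) + ennreal (b i)" for i
    using b[of i] by (simp add: less_top)
  then have "\<exists>U. U \<in> delta_covers \<delta> (A i) \<and>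
      (\<Sum>j. diam_weight s (U j)) < hausdorff_premeasure s \<delta> (A i) + ennreal (b i)" for i
    by (metis hausdorff_premeasure_approx)
  then obtain U where U: "\<And>i. U i \<in> delta_covers \<delta> (A i)"
    and less: "\<And>i. (\<Sum>j. diam_weight s (U i j)) < hausdorff_premeasure s \<delta> (A i) + ennreal (b i)"
    by metis
  define V where "V k = (case prod_decode k of (i, j) \<Rightarrow> U i j)" for k
  have "V \<in> delta_covers \<delta> (\<Union>i. A i)"
  proof -
    have "x \<in> (\<Union>k. V k)" if x: "x \<in> A i" for x i
    proof -
      obtain j where "x \<in> U i j" using delta_coversD(1)[OF U[of i]] x by blast
      then have "x \<in> V (prod_encode (i, j))" by (simp add: V_def)
      then show ?thesis by blast
    qed
    moreover have "bounded (V k) \<and> diameter (V k) \<le> \<delta>" for k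
      using delta_coversD(2,3)[OF U] by (simp add: V_def split: prod.split)
    ultimately show ?thesis by (auto simp: delta_covers_def)
  qed
  then have "hausdorff_premeasure s \<delta> (\<Union>i. A i) \<le> (\<Sum>k. diam_weight s (V k))"
    by (rule hausdorff_premeasure_le)
  also have "\<dots> = (\<Sum>k. (\<lambda>(i, j). diam_weight s (U i j)) (prod_decode k))"
    by (simp add: V_def case_prod_beta)
  also have "\<dots> = (\<Sum>i. \<Sum>j. diam_weight s (U i j))"
    by (rule suminf_ennreal_2dimen) simp
  also have "\<dots> \<le> (\<Sum>i. hausdorff_premeasure s \<delta> (A i) + ennreal (b i))"
    by (intro suminf_le less_imp_le less) auto
  also have "\<dots> = (\<Sum>i. hausdorff_premeasure s \<delta> (A i)) + (\<Sum>i. ennreal (b i))"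
    by (rule suminf_add[symmetric]) auto
  also have "(\<Sum>i. ennreal (b i)) = ennreal e"
  proof (rule suminf_ennreal_eq)
    show "(\<lambda>i. b i) sums e"
      unfolding b_def using sums_mult[OF power_half_series, of e] by simp
  qed (simp add: b less_imp_le)
  finally show "hausdorff_premeasure s \<delta> (\<Union>i. A i)
      \<le> (\<Sum>i. hausdorff_premeasure s \<delta> (A i)) + ennreal e" .
qed

lemma hausdorff_premeasure_Un_le:
  assumes "0 \<le> \<delta>"
  shows "hausdorff_premeasure s \<delta> (A \<union> B)
    \<le> hausdorff_premeasure s \<delta> A + hausdorff_premeasure s \<delta> B"
proof -
  let ?S = "\<lambda>i::nat. if i = 0 then A else if i = 1 then B else {}"
  have "A \<union> B = (\<Union>i. ?S i)" by (auto split: if_splits)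
  then have "hausdorff_premeasure s \<delta> (A \<union> B) \<le> (\<Sum>i. hausdorff_premeasure s \<delta> (?S i))"
    using hausdorff_premeasure_countable_subadditive[of s \<delta> ?S] by simp
  also have "\<dots> = (\<Sum>i\<in>{0,1}. hausdorff_premeasure s \<delta> (?S i))"
    by (rule suminf_finite) (use assms in auto)
  finally show ?thesis by simp
qed

lemma hausdorff_premeasure_UN_le:
  assumes "finite I" and "0 \<le> \<delta>"
  shows "hausdorff_premeasure s \<delta> (\<Union>i\<in>I. A i) \<le> (\<Sum>i\<in>I. hausdorff_premeasure s \<delta> (A i))"
  using assms(1)
proof (induction I)
  case (insert i I)
  have "hausdorff_premeasure s \<delta> (\<Union>i\<in>insert i I. A i)
      \<le> hausdorff_premeasure s \<delta> (A i) + hausdorff_premeasure s \<delta> (\<Union>i\<in>I. A i)"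
    using hausdorff_premeasure_Un_le[OF assms(2)] by simp
  also have "\<dots> \<le> hausdorff_premeasure s \<delta> (A i) + (\<Sum>i\<in>I. hausdorff_premeasure s \<delta> (A i))"
    by (intro add_left_mono insert.IH)
  finally show ?case using insert by simp
qed (use assms in simp)

lemma hausdorff_measure_mono: "A \<subseteq> B \<Longrightarrow> hausdorff_measure s A \<le> hausdorff_measure s B"
  unfolding hausdorff_measure_def by (intro SUP_mono') (simp add: hausdorff_premeasure_mono)

lemma hausdorff_premeasure_le_measure:
  "0 < \<delta> \<Longrightarrow> hausdorff_premeasure s \<delta> A \<le> hausdorff_measure s A"
  unfolding hausdorff_measure_def by (intro SUP_upper) simp

lemma hausdorff_measure_UN_le:
  assumes "finite I"
  shows "hausdorff_measure s (\<Union>i\<in>I. A i) \<le> (\<Sum>i\<in>I. hausdorff_measure s (A i))"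
  unfolding hausdorff_measure_def[of s "\<Union>i\<in>I. A i"]
proof (rule SUP_least)
  fix \<delta> :: real assume "\<delta> \<in> {0<..}"
  then have \<delta>: "0 < \<delta>" by simp
  have "hausdorff_premeasure s \<delta> (\<Union>i\<in>I. A i) \<le> (\<Sum>i\<in>I. hausdorff_premeasure s \<delta> (A i))"
    using assms \<delta> by (intro hausdorff_premeasure_UN_le) auto
  also have "\<dots> \<le> (\<Sum>i\<in>I. hausdorff_measure s (A i))"
    by (intro sum_mono hausdorff_premeasure_le_measure \<delta>)
  finally show "hausdorff_premeasure s \<delta> (\<Union>i\<in>I. A i) \<le> (\<Sum>i\<in>I. hausdorff_measure s (A i))" .
qed

text \<open>A set of diameter at most \<delta> cannot meet both \<open>A\<close> and
  \<open>B\<close>, so a cover of the union splits into a cover of each part, and no set is paid for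
  twice.\<close>

lemma hausdorff_premeasure_superadditive:
  assumes gap: "\<And>a b. a \<in> A \<Longrightarrow> b \<in> B \<Longrightarrow> \<delta> < dist a b" and \<delta>: "0 \<le> \<delta>"
  shows "hausdorff_premeasure s \<delta> A + hausdorff_premeasure s \<delta> B
    \<le> hausdorff_premeasure s \<delta> (A \<union> B)"
  unfolding hausdorff_premeasure_def[of s \<delta> "A \<union> B"]
proof (rule INF_greatest)
  fix U assume U: "U \<in> delta_covers \<delta> (A \<union> B)"
  note D = delta_coversD[OF U]
  \<comment> \<open>Discarded sets become empty and keep their index, so the two covers can be
    compared with \<open>U\<close> term by term.\<close>
  define V where "V X i = (if U i \<inter> X = {} then {} else U i)" for X i
  have V: "V X \<in> delta_covers \<delta> X" if X: "X \<subseteq> A \<union> B" for X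
  proof -
    have "x \<in> (\<Union>i. V X i)" if x: "x \<in> X" for x
    proof -
      obtain i where "x \<in> U i" using D(1) x X by blast
      then have "x \<in> V X i" using x by (auto simp: V_def)
      then show ?thesis by blast
    qed
    then show ?thesis using D(2,3) \<delta> by (auto simp: delta_covers_def V_def)
  qed
  have le: "diam_weight s (V A i) + diam_weight s (V B i) \<le> diam_weight s (U i)" for i
  proof -
    have "U i \<inter> A = {} \<or> U i \<inter> B = {}"
    proof (rule ccontr)
      assume "\<not> ?thesis"
      then obtain a b where "a \<in> U i" "a \<in> A" "b \<in> U i" "b \<in> B" by blast
      then show False
        using gap[of a b] diameter_bounded_bound[OF D(2), of a i b] D(3)[of i] by force
    qed
    then show ?thesis by (auto simp: V_def diam_weight_def)
  qed
  have "hausdorff_premeasure s \<delta> A + hausdorff_premeasure s \<delta> B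
      \<le> (\<Sum>i. diam_weight s (V A i)) + (\<Sum>i. diam_weight s (V B i))"
    by (intro add_mono hausdorff_premeasure_le V) auto
  also have "\<dots> = (\<Sum>i. diam_weight s (V A i) + diam_weight s (V B i))"
    by (rule suminf_add) auto
  also have "\<dots> \<le> (\<Sum>i. diam_weight s (U i))"
    by (intro suminf_le le) auto
  finally show "hausdorff_premeasure s \<delta> A + hausdorff_premeasure s \<delta> B
      \<le> (\<Sum>i. diam_weight s (U i))" .
qed

text \<open>This replaces additivity of the measure on Borel sets. Premeasures grow as the scale
  shrinks, so the two suprema can be taken at a common scale, and that scale may be assumed smaller
  than the gap.\<close>

lemma hausdorff_measure_superadditive:
  assumes gap: "\<And>a b. a \<in> A \<Longrightarrow> b \<in> B \<Longrightarrow> g \<le> dist a b" and g: "0 < g"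
  shows "hausdorff_measure s A + hausdorff_measure s B \<le> hausdorff_measure s (A \<union> B)"
proof -
  have "hausdorff_measure s A + hausdorff_measure s B
      = (SUP \<delta>\<in>{0<..}. hausdorff_premeasure s \<delta> A + hausdorff_premeasure s \<delta> B)"
    unfolding hausdorff_measure_def
  proof (rule SUP_add_directed_ennreal[symmetric])
    fix i j :: real assume "i \<in> {0<..}" "j \<in> {0<..}"
    then show "\<exists>k\<in>{0<..}. hausdorff_premeasure s i A + hausdorff_premeasure s j B
        \<le> hausdorff_premeasure s k A + hausdorff_premeasure s k B"
      by (intro bexI[of _ "min i j"] add_mono hausdorff_premeasure_antimono) auto
  qed
  also have "\<dots> \<le> hausdorff_measure s (A \<union> B)"
  proof (rule SUP_least)
    fix \<delta> :: real assume \<delta>: "\<delta> \<in> {0<..}"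
    let ?m = "min \<delta> (g / 2)"
    have m: "0 < ?m" "?m < g" using \<delta> g by auto
    have "hausdorff_premeasure s \<delta> A + hausdorff_premeasure s \<delta> B
        \<le> hausdorff_premeasure s ?m A + hausdorff_premeasure s ?m B"
      by (intro add_mono hausdorff_premeasure_antimono) auto
    also have "\<dots> \<le> hausdorff_premeasure s ?m (A \<union> B)"
      using gap m by (intro hausdorff_premeasure_superadditive) force+
    also have "\<dots> \<le> hausdorff_measure s (A \<union> B)"
      by (rule hausdorff_premeasure_le_measure[OF m(1)])
    finally show "hausdorff_premeasure s \<delta> A + hausdorff_premeasure s \<delta> B
        \<le> hausdorff_measure s (A \<union> B)" .
  qed
  finally show ?thesis .
qed

lemma hausdorff_measure_UN_superadditive:
  assumes "finite I" and g: "0 < g"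
    and gap: "\<And>i j a b. i \<in> I \<Longrightarrow> j \<in> I \<Longrightarrow> i \<noteq> j \<Longrightarrow> a \<in> A i \<Longrightarrow> b \<in> A j \<Longrightarrow> g \<le> dist a b"
  shows "(\<Sum>i\<in>I. hausdorff_measure s (A i)) \<le> hausdorff_measure s (\<Union>i\<in>I. A i)"
  using assms(1) gap
proof (induction I)
  case (insert i I)
  have "(\<Sum>i\<in>insert i I. hausdorff_measure s (A i))
      \<le> hausdorff_measure s (A i) + hausdorff_measure s (\<Union>i\<in>I. A i)"
    using insert by (auto intro!: add_left_mono)
  also have "\<dots> \<le> hausdorff_measure s (A i \<union> (\<Union>i\<in>I. A i))"
  proof (rule hausdorff_measure_superadditive[OF _ g])
    fix a b assume "a \<in> A i" "b \<in> (\<Union>i\<in>I. A i)"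
    then show "g \<le> dist a b" using insert.prems insert.hyps by fastforce
  qed
  finally show ?case by simp
qed simp

subsection \<open>Separated sets in regular spaces\<close>

text \<open>Maximality makes \<open>A\<close> a net: a point at distance at least \<open>e\<close>
  from all of \<open>A\<close> could be added to it.\<close>

lemma maximal_separated_dist_less:
  assumes "maximal_separated F e A" and "x \<in> F" and "0 < e"
  obtains p where "p \<in> A" and "dist p x < e"
proof (cases "x \<in> A")
  case True
  then show ?thesis using that[of x] assms by simp
next
  case False
  then have "\<not> r_separated e (insert x A)" and "r_separated e A"
    using assms by (auto simp: maximal_separated_def)
  then obtain p where "p \<in> A" "\<not> e \<le> dist p x"
    unfolding r_separated_def by (auto simp: dist_commute)
  then show ?thesis using that by auto
qed

lemma r_separated_subset: "r_separated e A \<Longrightarrow> B \<subseteq> A \<Longrightarrow> r_separated e B"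
  by (auto simp: r_separated_def)

locale regular_space =
  fixes F :: "'a::metric_space set" and s C :: real
  assumes s_nonneg: "0 \<le> s" and C_pos: "0 < C" and compact_F: "compact F"
    and lower: "\<And>r x. 0 < r \<Longrightarrow> r < 1 \<Longrightarrow> x \<in> F \<Longrightarrow>
      ennreal (r powr s / C) \<le> hausdorff_measure s (cball x r \<inter> F)"
    and upper: "\<And>r x. 0 < r \<Longrightarrow> r < 1 \<Longrightarrow> x \<in> F \<Longrightarrow>
      hausdorff_measure s (cball x r \<inter> F) \<le> ennreal (C * r powr s)"
begin

text \<open>Packing: the balls of radius \<open>e / 3\<close> about the points of \<open>A\<close>
  keep distance \<open>e / 3\<close> from each other and lie in \<open>cball y (2 * d)\<close>,
  because \<open>e \<le> 3 * d\<close>. Lower regularity for the small balls and upper regularity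
  for the large one bound their number.\<close>

lemma separated_card_le:
  assumes A: "A \<subseteq> F \<inter> cball y d" and y: "y \<in> F" and sep: "r_separated e A"
    and e: "0 < e" "e \<le> 3 * d" and d: "2 * d < 1"
  shows "finite A \<and> real (card A) \<le> C\<^sup>2 * (6 * d / e) powr s"
proof -
  let ?b = "C\<^sup>2 * (6 * d / e) powr s"
  \<comment> \<open>Finiteness of \<open>A\<close> is itself a conclusion: it follows from a uniform
    bound on the finite subsets.\<close>
  have bound: "real (card B) \<le> ?b" if B: "B \<subseteq> A" "finite B" for B
  proof -
    have "ennreal (real (card B) * ((e / 3) powr s / C)) = (\<Sum>p\<in>B. ennreal ((e / 3) powr s / C))"
      by (simp only: sum_constant ennreal_of_nat_eq_real_of_nat, rule ennreal_mult') simp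
    also have "\<dots> \<le> (\<Sum>p\<in>B. hausdorff_measure s (cball p (e / 3) \<inter> F))"
      using B A e d by (intro sum_mono lower) auto
    also have "\<dots> \<le> hausdorff_measure s (\<Union>p\<in>B. cball p (e / 3) \<inter> F)"
    proof (rule hausdorff_measure_UN_superadditive)
      fix p q a b
      assume "p \<in> B" "q \<in> B" "p \<noteq> q" and a: "a \<in> cball p (e / 3) \<inter> F"
        and b: "b \<in> cball q (e / 3) \<inter> F"
      then have "e \<le> dist p q"
        using sep B by (auto simp: r_separated_def)
      moreover have "dist p q \<le> dist p a + dist a b + dist q b"
        by metric
      ultimately show "e / 3 \<le> dist a b" using a b by auto
    qed (use B e in auto)
    also have "\<dots> \<le> hausdorff_measure s (cball y (2 * d) \<inter> F)"
    proof (rule hausdorff_measure_mono, safe)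
      fix p x assume "p \<in> B" and x: "x \<in> cball p (e / 3)"
      then have "dist y p \<le> d" using A B by auto
      moreover have "dist y x \<le> dist y p + dist p x" by metric
      ultimately show "x \<in> cball y (2 * d)" using x e by auto
    qed
    also have "\<dots> \<le> ennreal (C * (2 * d) powr s)"
      using e d y by (intro upper) auto
    finally have "real (card B) * ((e / 3) powr s / C) \<le> C * (2 * d) powr s"
      using C_pos by (simp add: ennreal_le_iff)
    then have "real (card B) * (e / 3) powr s \<le> C\<^sup>2 * (2 * d) powr s"
      using C_pos by (simp add: field_simps power2_eq_square)
    also have "(2 * d) powr s = (6 * d / e) powr s * (e / 3) powr s"
      using e by (subst powr_mult[symmetric]) (auto simp: field_simps)
    finally show ?thesis
      using e by (simp add: mult.assoc[symmetric])
  qed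
  have "finite A \<and> card A \<le> nat \<lfloor>?b\<rfloor>"
    using bound by (intro finite_if_finite_subsets_card_bdd) (auto simp: le_nat_floor)
  then show ?thesis using bound by auto
qed

text \<open>Covering, dual to the packing bound: the balls of radius \<open>e\<close> about
  \<open>A\<close> cover \<open>cball x (r / 4) \<inter> F\<close>, and those that are used have
  centres within \<open>r / 4 + e \<le> r / 2\<close> of \<open>x\<close>.\<close>

lemma maximal_separated_card_ge:
  assumes A: "maximal_separated F e A" and x: "x \<in> F" and e: "0 < e" "4 * e \<le> r" and r: "r < 1"
  shows "(r / (4 * e)) powr s / C\<^sup>2 \<le> real (card (A \<inter> cball x (r / 2)))"
proof -
  let ?S = "A \<inter> cball x (r / 2)"
  have S: "?S \<subseteq> F \<inter> cball x (r / 2)" "r_separated e ?S" and AF: "A \<subseteq> F"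
    using A by (auto simp: maximal_separated_def intro: r_separated_subset)
  have fin: "finite ?S"
    using separated_card_le[OF S(1) x S(2)] e r by simp
  have "ennreal ((r / 4) powr s / C) \<le> hausdorff_measure s (cball x (r / 4) \<inter> F)"
    using x e r by (intro lower) auto
  also have "\<dots> \<le> hausdorff_measure s (\<Union>p\<in>?S. cball p e \<inter> F)"
  proof (rule hausdorff_measure_mono, rule subsetI)
    fix z assume z: "z \<in> cball x (r / 4) \<inter> F"
    obtain p where p: "p \<in> A" "dist p z < e"
      using maximal_separated_dist_less[OF A _ e(1), of z] z by blast
    have "dist x p \<le> dist x z + dist p z" by metric
    then have "p \<in> ?S" using p z e by auto
    then show "z \<in> (\<Union>p\<in>?S. cball p e \<inter> F)" using p(2) z by (intro UN_I[of p]) auto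
  qed
  also have "\<dots> \<le> (\<Sum>p\<in>?S. hausdorff_measure s (cball p e \<inter> F))"
    by (rule hausdorff_measure_UN_le[OF fin])
  also have "\<dots> \<le> (\<Sum>p\<in>?S. ennreal (C * e powr s))"
    using AF e r by (intro sum_mono upper) auto
  also have "\<dots> = ennreal (real (card ?S) * (C * e powr s))"
    by (simp only: sum_constant ennreal_of_nat_eq_real_of_nat, rule ennreal_mult'[symmetric]) simp
  finally have "(r / 4) powr s / C \<le> real (card ?S) * (C * e powr s)"
    using C_pos by (subst (asm) ennreal_le_iff) auto
  then have "(r / 4) powr s / C\<^sup>2 \<le> real (card ?S) * e powr s"
    using C_pos by (simp add: field_simps power2_eq_square)
  also have "(r / 4) powr s = (r / (4 * e)) powr s * e powr s"
    using e by (subst powr_mult[symmetric]) (auto simp: field_simps)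
  finally have "e powr s * ((r / (4 * e)) powr s / C\<^sup>2)
      \<le> e powr s * real (card ?S)"
    by (simp add: mult.commute)
  then show ?thesis
    using e by (subst (asm) mult_le_cancel_left_pos) auto
qed

lemma separated_card_le_global:
  obtains K where "0 \<le> K"
    and "\<And>e A. 0 < e \<Longrightarrow> e \<le> 1 \<Longrightarrow> A \<subseteq> F \<Longrightarrow> r_separated e A \<Longrightarrow>
      finite A \<and> real (card A) \<le> K * (1 / e) powr s"
proof -
  \<comment> \<open>The packing bound is local. The radius \<open>d = 2 / 5\<close> satisfies both
    of its conditions, \<open>2 * d < 1\<close> and \<open>e \<le> 3 * d\<close>, for every
    \<open>e \<le> 1\<close>.\<close>
  obtain Y where Y: "finite Y" "Y \<subseteq> F" "F \<subseteq> (\<Union>y\<in>Y. ball y (2 / 5))"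
    using compactE_image[OF compact_F, of F "\<lambda>y. ball y (2 / 5)"] by force
  let ?K = "real (card Y) * (C\<^sup>2 * (12 / 5) powr s)"
  show thesis
  proof (rule that[of ?K])
    fix e :: real and A :: "'a set"
    assume e: "0 < e" "e \<le> 1" and A: "A \<subseteq> F" "r_separated e A"
    have local: "finite (A \<inter> cball y (2 / 5)) \<and>
        real (card (A \<inter> cball y (2 / 5))) \<le> C\<^sup>2 * (12 / 5) powr s * (1 / e) powr s"
      if "y \<in> Y" for y
    proof -
      have "finite (A \<inter> cball y (2 / 5)) \<and>
          real (card (A \<inter> cball y (2 / 5))) \<le> C\<^sup>2 * (6 * (2 / 5) / e) powr s"
        using that Y e A by (intro separated_card_le) (auto intro: r_separated_subset)
      moreover have "(6 * (2 / 5) / e) powr s = (12 / 5) powr s * (1 / e) powr s"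
        using e by (subst powr_mult[symmetric]) auto
      ultimately show ?thesis by simp
    qed
    have A_eq: "A = (\<Union>y\<in>Y. A \<inter> cball y (2 / 5))"
      using Y(3) A(1) by force
    have "real (card A) \<le> real (\<Sum>y\<in>Y. card (A \<inter> cball y (2 / 5)))"
      by (subst A_eq) (intro of_nat_mono card_UN_le Y(1))
    also have "\<dots> \<le> (\<Sum>y\<in>Y. C\<^sup>2 * (12 / 5) powr s * (1 / e) powr s)"
      unfolding of_nat_sum using local by (intro sum_mono) auto
    finally show "finite A \<and> real (card A) \<le> ?K * (1 / e) powr s"
      using A_eq local Y(1) finite_UN_I[of Y "\<lambda>y. A \<inter> cball y (2 / 5)"] by auto
  qed simp
qed

end

subsection \<open>Upper bound\<close>

lemma diameter_cball_Int_le: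
  assumes "0 \<le> r"
  shows "diameter (cball p r \<inter> F) \<le> 2 * r"
proof (rule diameter_le_dist)
  fix x y assume "x \<in> cball p r \<inter> F" "y \<in> cball p r \<inter> F"
  moreover have "dist x y \<le> dist p x + dist p y" by metric
  ultimately show "dist x y \<le> 2 * r" by auto
qed (use assms in simp)

lemma diam_weight_cball_le:
  assumes "0 < u" and "0 \<le> r"
  shows "diam_weight u (cball p r \<inter> F) \<le> ennreal ((2 * r) powr u)"
proof -
  have "diameter (cball p r \<inter> F) \<le> 2 * r"
    by (rule diameter_cball_Int_le[OF assms(2)])
  moreover have "0 \<le> diameter (cball p r \<inter> F)"
    by (intro diameter_ge_0 bounded_Int) auto
  ultimately show ?thesis
    using assms by (auto simp: diam_weight_def intro!: ennreal_leI powr_mono2)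
qed

context regular_space
begin

text \<open>Level \<open>q\<close> consists of at most \<open>K * q powr s\<close> balls of radius
  \<open>q powr (-t)\<close>, at total cost \<open>a q\<close>. As \<open>s - t * u < -1\<close>,
  these costs are summable, and the levels beyond any \<open>N\<close> cover the limsup set.\<close>

lemma hausdorff_measure_well_approximable_eq_0:
  assumes P: "abstract_rationals F P" and t: "1 \<le> t" and u: "s + 1 < t * u"
  shows "hausdorff_measure u (well_approximable F P t) = 0"
proof -
  obtain K where K: "0 \<le> K"
    and card: "\<And>e A. 0 < e \<Longrightarrow> e \<le> 1 \<Longrightarrow> A \<subseteq> F \<Longrightarrow> r_separated e A \<Longrightarrow>
      finite A \<and> real (card A) \<le> K * (1 / e) powr s"
    using separated_card_le_global by blast
  have "0 < t * u" using u s_nonneg by simp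
  then have u0: "0 < u" using t by (simp add: zero_less_mult_iff)
  define a where "a q = K * 2 powr u * real q powr (s - t * u)" for q :: nat
  have a_nonneg: "0 \<le> a q" for q
    using K by (simp add: a_def)
  have "summable a"
    unfolding a_def using u by (intro summable_mult) (simp add: summable_real_powr_iff)
  have pre_le: "hausdorff_premeasure u \<delta> (well_approximable F P t) \<le> 0 + ennreal e"
    if \<delta>: "0 < \<delta>" and e: "0 < e" for \<delta> e :: real
  proof -
    obtain n1 where n1: "\<And>n. n \<ge> n1 \<Longrightarrow> norm (\<Sum>i. a (i + n)) < e"
      using suminf_exist_split[OF e \<open>summable a\<close>] by blast
    obtain n2 :: nat where n2: "2 / \<delta> < real n2"
      using reals_Archimedean2 by blast
    \<comment> \<open>Beyond \<open>n1\<close> the tail of the costs is below \<open>e\<close>;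
      beyond \<open>n2\<close> the balls have diameter at most \<delta>, since
      \<open>q powr t\<close> is at least \<open>q\<close>.\<close>
    define N where "N = max n1 n2"
    have level: "hausdorff_premeasure u \<delta> (\<Union>p\<in>P q. cball p (1 / real q powr t) \<inter> F) \<le> ennreal (a q)"
      if q: "q > N" for q
    proof -
      have q1: "real q \<ge> 1" and "real q \<ge> real n2"
        using q by (auto simp: N_def)
      then have "2 / \<delta> < real q" using n2 by simp
      moreover have "real q powr 1 \<le> real q powr t"
        using q1 t by (intro powr_mono) auto
      ultimately have "2 / \<delta> \<le> real q powr t" using q1 by simp
      then have small: "2 * (1 / real q powr t) \<le> \<delta>"
        using \<delta> q1 by (simp add: field_simps)
      have "P q \<subseteq> F" "r_separated (1 / real q) (P q)"
        using P q1 by (auto simp: abstract_rationals_def maximal_separated_def)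
      then have fin: "finite (P q)" and card_q: "real (card (P q)) \<le> K * real q powr s"
        using card[of "1 / real q" "P q"] q1 by auto
      have "hausdorff_premeasure u \<delta> (\<Union>p\<in>P q. cball p (1 / real q powr t) \<inter> F)
          \<le> (\<Sum>p\<in>P q. hausdorff_premeasure u \<delta> (cball p (1 / real q powr t) \<inter> F))"
        using \<delta> by (intro hausdorff_premeasure_UN_le fin) simp
      also have "\<dots> \<le> (\<Sum>p\<in>P q. ennreal ((2 * (1 / real q powr t)) powr u))"
      proof (rule sum_mono)
        fix p
        let ?B = "cball p (1 / real q powr t) \<inter> F"
        have "diameter ?B \<le> 2 * (1 / real q powr t)"
          by (rule diameter_cball_Int_le) simp
        then have "hausdorff_premeasure u \<delta> ?B \<le> diam_weight u ?B"
          using small \<delta> by (intro hausdorff_premeasure_le_diam_weight bounded_Int) auto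
        also have "\<dots> \<le> ennreal ((2 * (1 / real q powr t)) powr u)"
          by (rule diam_weight_cball_le[OF u0]) simp
        finally show "hausdorff_premeasure u \<delta> ?B \<le> \<dots>" .
      qed
      also have "\<dots> = ennreal (real (card (P q)) * (2 * (1 / real q powr t)) powr u)"
        by (simp only: sum_constant ennreal_of_nat_eq_real_of_nat, rule ennreal_mult'[symmetric]) simp
      also have "\<dots> \<le> ennreal (K * real q powr s * (2 * (1 / real q powr t)) powr u)"
        by (intro ennreal_leI mult_right_mono card_q) simp
      also have "K * real q powr s * (2 * (1 / real q powr t)) powr u = a q"
        using q1 by (simp add: a_def powr_mult powr_divide powr_powr powr_diff)
      finally show ?thesis .
    qed
    have "well_approximable F P t
        \<subseteq> (\<Union>i. \<Union>p\<in>P (i + Suc N). cball p (1 / real (i + Suc N) powr t) \<inter> F)"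
    proof
      fix x assume "x \<in> well_approximable F P t"
      then obtain q where q: "q > N" and x: "x \<in> (\<Union>p\<in>P q. cball p (1 / real q powr t) \<inter> F)"
        unfolding well_approximable_def by blast
      obtain i where "q = i + Suc N"
        using q by (intro that[of "q - Suc N"]) simp
      with x have "x \<in> (\<Union>p\<in>P (i + Suc N). cball p (1 / real (i + Suc N) powr t) \<inter> F)"
        by (simp only:)
      then show "x \<in> (\<Union>i. \<Union>p\<in>P (i + Suc N). cball p (1 / real (i + Suc N) powr t) \<inter> F)"
        by (rule UN_I[OF UNIV_I])
    qed
    then have "hausdorff_premeasure u \<delta> (well_approximable F P t) \<le> hausdorff_premeasure u \<delta>
        (\<Union>i. \<Union>p\<in>P (i + Suc N). cball p (1 / real (i + Suc N) powr t) \<inter> F)"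
      by (rule hausdorff_premeasure_mono)
    also have "\<dots> \<le> (\<Sum>i. hausdorff_premeasure u \<delta>
        (\<Union>p\<in>P (i + Suc N). cball p (1 / real (i + Suc N) powr t) \<inter> F))"
      by (rule hausdorff_premeasure_countable_subadditive)
    also have "\<dots> \<le> (\<Sum>i. ennreal (a (i + Suc N)))"
      by (intro suminf_le level) auto
    also have "\<dots> = ennreal (\<Sum>i. a (i + Suc N))"
      by (intro suminf_ennreal2 a_nonneg summable_ignore_initial_segment \<open>summable a\<close>)
    also have "\<dots> \<le> ennreal e"
    proof (rule ennreal_leI)
      have "n1 \<le> Suc N" by (simp add: N_def)
      from n1[OF this] show "(\<Sum>i. a (i + Suc N)) \<le> e" by simp
    qed
    finally show ?thesis by simp
  qed
  have "hausdorff_premeasure u \<delta> (well_approximable F P t) \<le> 0" if "0 < \<delta>" for \<delta>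
    by (rule ennreal_le_epsilon) (rule pre_le[OF that])
  then have "hausdorff_measure u (well_approximable F P t) \<le> 0"
    unfolding hausdorff_measure_def by (intro SUP_least) auto
  then show ?thesis by simp
qed

end

subsection \<open>Lower bound\<close>

text \<open>An upper estimate for how much of the cover \<open>U\<close> is spent on
  \<open>B\<close>. As a real series it is meaningful for summable \<open>w\<close>, which the
  lemmas about it assume.\<close>

definition hit_weight :: "(nat \<Rightarrow> 'a set) \<Rightarrow> (nat \<Rightarrow> real) \<Rightarrow> 'a set \<Rightarrow> real" where
  "hit_weight U w B = (\<Sum>i. if U i \<inter> B = {} then 0 else w i)"

lemma summable_hit:
  fixes w :: "nat \<Rightarrow> real"
  assumes "summable w" and "\<And>i. 0 \<le> w i"
  shows "summable (\<lambda>i. if U i \<inter> B = {} then 0 else w i)"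
  by (rule summable_comparison_test[OF _ assms(1)]) (use assms(2) in auto)

lemma sum_le_hit_weight:
  assumes "summable w" and "\<And>i. 0 \<le> w i" and "finite I" and "\<And>i. i \<in> I \<Longrightarrow> U i \<inter> B \<noteq> {}"
  shows "(\<Sum>i\<in>I. w i) \<le> hit_weight U w B"
proof -
  have "(\<Sum>i\<in>I. w i) = (\<Sum>i\<in>I. if U i \<inter> B = {} then 0 else w i)"
    by (rule sum.cong) (use assms in auto)
  also have "\<dots> \<le> hit_weight U w B"
    unfolding hit_weight_def using assms by (intro sum_le_suminf summable_hit) auto
  finally show ?thesis .
qed

lemma weight_le_hit_weight:
  assumes "summable w" and "\<And>i. 0 \<le> w i" and "U i \<inter> B \<noteq> {}"
  shows "w i \<le> hit_weight U w B"
  using sum_le_hit_weight[of w "{i}" U B] assms by simp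

lemma hit_weight_le_suminf:
  assumes "summable w" and "\<And>i. 0 \<le> w i"
  shows "hit_weight U w B \<le> suminf w"
  unfolding hit_weight_def using assms by (intro suminf_le summable_hit) auto

text \<open>After exchanging the sums, \<open>once\<close> leaves at most one nonzero term for each
  \<open>i\<close>, and by \<open>sub\<close> a set with such a term also meets
  \<open>B'\<close>.\<close>

lemma sum_hit_weight_le:
  assumes w: "summable w" "\<And>i. 0 \<le> w i" and G: "finite G"
    and sub: "\<And>p. p \<in> G \<Longrightarrow> B p \<subseteq> B'"
    and once: "\<And>i p q. p \<in> G \<Longrightarrow> q \<in> G \<Longrightarrow> U i \<inter> B p \<noteq> {} \<Longrightarrow> U i \<inter> B q \<noteq> {} \<Longrightarrow> p = q"
  shows "(\<Sum>p\<in>G. hit_weight U w (B p)) \<le> hit_weight U w B'"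
proof -
  have le: "(\<Sum>p\<in>G. if U i \<inter> B p = {} then 0 else w i) \<le> (if U i \<inter> B' = {} then 0 else w i)" for i
  proof (cases "\<exists>p\<in>G. U i \<inter> B p \<noteq> {}")
    case True
    then obtain p where p: "p \<in> G" "U i \<inter> B p \<noteq> {}" by blast
    have "(\<Sum>q\<in>G. if U i \<inter> B q = {} then 0 else w i) = (\<Sum>q\<in>G. if q = p then w i else 0)"
      using once p by (intro sum.cong) auto
    then show ?thesis using p sub[OF p(1)] G by auto
  next
    case False
    then show ?thesis using w by simp
  qed
  have "(\<Sum>p\<in>G. hit_weight U w (B p)) = (\<Sum>i. \<Sum>p\<in>G. if U i \<inter> B p = {} then 0 else w i)"
    unfolding hit_weight_def by (intro suminf_sum[symmetric] summable_hit w)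
  also have "\<dots> \<le> hit_weight U w B'"
    unfolding hit_weight_def by (intro suminf_le le summable_sum summable_hit w)
  finally show ?thesis .
qed

section \<open>One descent step: from a ball to a much smaller ball inside it\<close>

context regular_space
begin

text \<open>This limits the damage done by one large set. If it contains a point \<open>y\<close> of
  \<open>F\<close>, then all centres counted lie within \<open>d + r \<le> 2 * d\<close> of
  \<open>y\<close>, and the packing bound applies with radius \<open>2 * d\<close>.\<close>

lemma hit_card_le:
  assumes A: "A \<subseteq> F" "r_separated e A" and e: "0 < e" "e \<le> 2 * d" and d: "4 * d < 1"
    and r: "4 * r \<le> e" and U: "\<And>x y. x \<in> U \<Longrightarrow> y \<in> U \<Longrightarrow> dist x y \<le> d"
  shows "real (card {p \<in> A. U \<inter> (cball p r \<inter> F) \<noteq> {}}) \<le> C\<^sup>2 * (12 * d / e) powr s"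
    (is "real (card ?H) \<le> _")
proof (cases "U \<inter> F = {}")
  case True
  then have "?H = {}" by blast
  then show ?thesis by (simp only: card.empty) simp
next
  case False
  then obtain y where y: "y \<in> U" "y \<in> F" by blast
  have "p \<in> cball y (2 * d)" if "p \<in> ?H" for p
  proof -
    obtain z where z: "z \<in> U" "dist p z \<le> r" using \<open>p \<in> ?H\<close> by auto
    have "dist y p \<le> dist y z + dist p z" by metric
    then show ?thesis using U[OF y(1) z(1)] z r e by auto
  qed
  then have "?H \<subseteq> F \<inter> cball y (2 * d)" using A by blast
  moreover have "r_separated e ?H" using A(2) by (rule r_separated_subset) auto
  ultimately show ?thesis
    using separated_card_le[of ?H y "2 * d" e] y e d by simp
qed

text \<open>A small set cannot bridge two balls: their centres would be within
  \<open>2 * r + d < e\<close> of each other.\<close>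

lemma hit_unique:
  assumes A: "r_separated e A" and d: "2 * d < e" and r: "4 * r \<le> e"
    and U: "\<And>x y. x \<in> U \<Longrightarrow> y \<in> U \<Longrightarrow> dist x y \<le> d"
    and p: "p \<in> A" "U \<inter> cball p r \<noteq> {}" and q: "q \<in> A" "U \<inter> cball q r \<noteq> {}"
  shows "p = q"
proof (rule ccontr)
  assume "p \<noteq> q"
  then have "e \<le> dist p q" using A p q by (auto simp: r_separated_def)
  obtain x where x: "x \<in> U" "dist p x \<le> r" using p by auto
  obtain y where y: "y \<in> U" "dist q y \<le> r" using q by auto
  have "dist p q \<le> dist p x + dist x y + dist q y" by metric
  then show False using U[OF x(1) y(1)] x y r d \<open>e \<le> dist p q\<close> by auto
qed

text \<open>Among the centres \<open>S\<close>, condition \<open>l_small\<close> ensures that the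
  large sets spoil at most half of the guaranteed number. On the remaining centres \<open>G\<close>
  the hit weights add up to at most that of the big ball, and \<open>gain\<close> says that
  \<open>G\<close> is numerous enough for an average to be admissible.\<close>

lemma hit_weight_descent:
  assumes A: "maximal_separated F e A" and p: "p \<in> F" and e: "0 < e" "4 * e \<le> r" and r: "r < 1"
    and u: "0 < u" "u \<le> s" and l: "0 < l" "4 * l < 1" and l_small: "C ^ 4 * (48 * l) powr s \<le> 1 / 2"
    and d: "\<And>i. 0 < d i" and U: "\<And>i x y. x \<in> U i \<Longrightarrow> y \<in> U i \<Longrightarrow> dist x y \<le> d i"
    and sum: "summable (\<lambda>i. d i powr u)"
    and hit: "hit_weight U (\<lambda>i. d i powr u) (cball p r \<inter> F) \<le> (l * r) powr u"
    and \<rho>: "0 < \<rho>" "4 * \<rho> \<le> e"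
    and gain: "2 * C\<^sup>2 * r powr u \<le> (r / (4 * e)) powr s * \<rho> powr u"
  obtains p' where "p' \<in> A" and "cball p' \<rho> \<subseteq> cball p r"
    and "hit_weight U (\<lambda>i. d i powr u) (cball p' \<rho> \<inter> F) \<le> (l * \<rho>) powr u"
proof -
  let ?w = "\<lambda>i. d i powr u"
  let ?B = "cball p r \<inter> F"
  define S where "S = A \<inter> cball p (r / 2)"
  have S: "S \<subseteq> F" "r_separated e S"
    using A by (auto simp: S_def maximal_separated_def intro: r_separated_subset)
  have S_fin: "finite S"
    using separated_card_le[OF _ p S(2), of "r / 2"] S(1) e r by (auto simp: S_def)
  have S_card: "(r / (4 * e)) powr s / C\<^sup>2 \<le> real (card S)"
    unfolding S_def by (rule maximal_separated_card_ge[OF A p e r])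
  have S_sub: "cball x \<rho> \<subseteq> cball p r" if "x \<in> S" for x
  proof
    fix z assume "z \<in> cball x \<rho>"
    moreover have "dist p z \<le> dist p x + dist x z" by metric
    ultimately show "z \<in> cball p r" using that \<rho> e by (auto simp: S_def)
  qed
  \<comment> \<open>A single set that meets the ball already accounts for \<open>d i powr u\<close>
    of the hit weight.\<close>
  have d_le: "d i \<le> l * r" if "U i \<inter> ?B \<noteq> {}" for i
  proof -
    have "d i powr u \<le> (l * r) powr u"
      using weight_le_hit_weight[of ?w U i ?B] that sum hit by auto
    moreover have "0 \<le> l * r" using l e by simp
    ultimately show ?thesis
      using powr_less_mono2[OF u(1), of "l * r" "d i"] by linarith
  qed
  define L where "L = {i. U i \<inter> ?B \<noteq> {} \<and> e \<le> 2 * d i}"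
  have "finite L"
  proof -
    have "\<forall>\<^sub>F i in sequentially. d i powr u < (e / 2) powr u"
      using summable_LIMSEQ_zero[OF sum] e by (intro order_tendstoD) auto
    then obtain n where n: "\<And>i. i \<ge> n \<Longrightarrow> d i powr u < (e / 2) powr u"
      by (auto simp: eventually_sequentially)
    have "i < n" if "i \<in> L" for i
    proof (rule ccontr)
      assume "\<not> i < n"
      then have "d i powr u < (e / 2) powr u" by (intro n) simp
      moreover have "(e / 2) powr u \<le> d i powr u"
        using that e u by (intro powr_mono2) (auto simp: L_def)
      ultimately show False by simp
    qed
    then have "L \<subseteq> {..<n}" by blast
    then show ?thesis by (rule finite_subset) simp
  qed
  define H where "H i = {x \<in> S. U i \<inter> (cball x \<rho> \<inter> F) \<noteq> {}}" for i
  let ?c = "C\<^sup>2 * (12 / e) powr s * (l * r) powr (s - u)"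
  \<comment> \<open>The power \<open>s\<close> of \<open>d i\<close> is split as
    \<open>(s - u) + u\<close>: the first factor is bounded through \<open>d_le\<close>, the second
    is kept because its sum over \<open>L\<close> is controlled by the hit weight.\<close>
  have H_card: "real (card (H i)) \<le> ?c * d i powr u" if "i \<in> L" for i
  proof -
    have i: "d i \<le> l * r" "e \<le> 2 * d i" using that d_le by (auto simp: L_def)
    have "l * r < 1 / 4 * 1" using l r e by (intro mult_strict_mono) auto
    then have "real (card (H i)) \<le> C\<^sup>2 * (12 * d i / e) powr s"
      unfolding H_def using i e \<rho> by (intro hit_card_le S U) auto
    also have "(12 * d i / e) powr s = (12 / e) powr s * (d i powr (s - u) * d i powr u)"
      using d[of i] e by (simp add: powr_add[symmetric] powr_mult[symmetric] less_imp_le)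
    also have "\<dots> \<le> (12 / e) powr s * ((l * r) powr (s - u) * d i powr u)"
      using i d[of i] u by (intro mult_left_mono mult_right_mono powr_mono2) auto
    finally show ?thesis using C_pos by (simp add: mult.assoc mult_left_mono)
  qed
  define G where "G = S - (\<Union>i\<in>L. H i)"
  have "real (card (\<Union>i\<in>L. H i)) \<le> (\<Sum>i\<in>L. real (card (H i)))"
    using card_UN_le[OF \<open>finite L\<close>, of H] by (simp flip: of_nat_sum)
  also have "\<dots> \<le> ?c * (\<Sum>i\<in>L. d i powr u)"
    unfolding sum_distrib_left by (intro sum_mono H_card)
  also have "\<dots> \<le> ?c * (l * r) powr u"
  proof (rule mult_left_mono)
    have "(\<Sum>i\<in>L. d i powr u) \<le> hit_weight U ?w ?B"
      by (rule sum_le_hit_weight[OF sum _ \<open>finite L\<close>]) (simp_all add: L_def)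
    then show "(\<Sum>i\<in>L. d i powr u) \<le> (l * r) powr u" using hit by linarith
  qed simp
  also have "\<dots> = C\<^sup>2 * ((12 / e) powr s * ((l * r) powr (s - u) * (l * r) powr u))"
    by (simp only: mult.assoc)
  also have "(12 / e) powr s * ((l * r) powr (s - u) * (l * r) powr u) = (12 / e * (l * r)) powr s"
    by (simp only: powr_add[symmetric] diff_add_cancel powr_mult[symmetric])
  \<comment> \<open>This isolates \<open>r / (4 * e)\<close>, so that the spoiled centres can be
    compared with the lower bound \<open>S_card\<close>; its divisor C^2 turns the factor C^2 into
    C^4.\<close>
  also have "12 / e * (l * r) = 48 * l * (r / (4 * e))"
    using e by (simp add: field_simps)
  also have "C\<^sup>2 * (48 * l * (r / (4 * e))) powr s
      = C ^ 4 * (48 * l) powr s * ((r / (4 * e)) powr s / C\<^sup>2)"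
    using e l C_pos by (subst powr_mult) (auto simp: field_simps power2_eq_square power4_eq_xxxx)
  also have "\<dots> \<le> 1 / 2 * ((r / (4 * e)) powr s / C\<^sup>2)"
    by (intro mult_right_mono l_small) auto
  finally have bad: "real (card (\<Union>i\<in>L. H i)) \<le> 1 / 2 * ((r / (4 * e)) powr s / C\<^sup>2)" .
  have "finite (\<Union>i\<in>L. H i)"
    by (rule finite_subset[OF _ S_fin]) (auto simp: H_def)
  then have "real (card S) - real (card (\<Union>i\<in>L. H i)) \<le> real (card G)"
    using diff_card_le_card_Diff[of "\<Union>i\<in>L. H i" S] unfolding G_def by linarith
  with S_card bad have G_card: "1 / 2 * ((r / (4 * e)) powr s / C\<^sup>2) \<le> real (card G)"
    by linarith
  have G_fin: "finite G" using S_fin by (simp add: G_def)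
  have total: "(\<Sum>x\<in>G. hit_weight U ?w (cball x \<rho> \<inter> F)) \<le> hit_weight U ?w ?B"
  proof (rule sum_hit_weight_le[OF sum _ G_fin])
    fix x assume "x \<in> G"
    then show "cball x \<rho> \<inter> F \<subseteq> ?B" using S_sub by (auto simp: G_def)
  next
    fix i x y assume x: "x \<in> G" "U i \<inter> (cball x \<rho> \<inter> F) \<noteq> {}"
      and y: "y \<in> G" "U i \<inter> (cball y \<rho> \<inter> F) \<noteq> {}"
    have "x \<in> S" "y \<in> S" using x y by (auto simp: G_def)
    have "x \<in> H i" using x \<open>x \<in> S\<close> by (simp add: H_def)
    then have "i \<notin> L" using x(1) by (auto simp: G_def)
    moreover have "U i \<inter> ?B \<noteq> {}" using x(2) S_sub[OF \<open>x \<in> S\<close>] by blast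
    ultimately have "2 * d i < e" by (auto simp: L_def)
    then show "x = y"
    proof (rule hit_unique[OF S(2) _ \<rho>(2)])
      show "dist a b \<le> d i" if "a \<in> U i" "b \<in> U i" for a b
        by (rule U[OF that])
    qed (use x y \<open>x \<in> S\<close> \<open>y \<in> S\<close> in blast)+
  qed simp
  \<comment> \<open>Averaging: if all of \<open>G\<close> exceeded the bound, the sum would exceed
    \<open>card G * (l * \<rho>) powr u\<close>, which \<open>gain\<close> makes at least
    \<open>(l * r) powr u\<close>.\<close>
  have "\<exists>x\<in>G. hit_weight U ?w (cball x \<rho> \<inter> F) \<le> (l * \<rho>) powr u"
  proof (rule ccontr)
    assume none: "\<not> ?thesis"
    have "0 < 1 / 2 * ((r / (4 * e)) powr s / C\<^sup>2)" using e C_pos by simp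
    then have "G \<noteq> {}" using G_card by force
    have "r powr u \<le> 1 / 2 * ((r / (4 * e)) powr s / C\<^sup>2) * \<rho> powr u"
      using gain C_pos by (simp add: field_simps)
    then have "l powr u * r powr u \<le> l powr u * (1 / 2 * ((r / (4 * e)) powr s / C\<^sup>2) * \<rho> powr u)"
      by (intro mult_left_mono) auto
    also have "\<dots> = 1 / 2 * ((r / (4 * e)) powr s / C\<^sup>2) * (l powr u * \<rho> powr u)"
      by simp
    also have "\<dots> \<le> real (card G) * (l powr u * \<rho> powr u)"
      by (intro mult_right_mono G_card) auto
    also have "\<dots> = (\<Sum>x\<in>G. (l * \<rho>) powr u)"
      using l \<rho> by (simp add: powr_mult)
    also have "\<dots> < (\<Sum>x\<in>G. hit_weight U ?w (cball x \<rho> \<inter> F))"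
      using none by (intro sum_strict_mono G_fin \<open>G \<noteq> {}\<close>) auto
    also have "\<dots> \<le> (l * r) powr u" using total hit by simp
    finally show False using l e by (simp add: powr_mult)
  qed
  then obtain x where "x \<in> G" "hit_weight U ?w (cball x \<rho> \<inter> F) \<le> (l * \<rho>) powr u" by blast
  then show thesis using that[of x] S_sub by (auto simp: G_def S_def)
qed

end

section \<open>Choice of levels, iteration of the descent, and positivity of the measure\<close>

context regular_space
begin

lemma hit_weight_step:
  assumes P: "abstract_rationals F P" and t: "1 \<le> t" and u: "0 < u" "t * u < s"
    and p: "p \<in> F" and r: "0 < r" "r < 1"
    and l: "0 < l" "4 * l < 1" and l_small: "C ^ 4 * (48 * l) powr s \<le> 1 / 2"
    and d: "\<And>i. 0 < d i" and U: "\<And>i x y. x \<in> U i \<Longrightarrow> y \<in> U i \<Longrightarrow> dist x y \<le> d i"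
    and sum: "summable (\<lambda>i. d i powr u)"
    and hit: "hit_weight U (\<lambda>i. d i powr u) (cball p r \<inter> F) \<le> (l * r) powr u"
  obtains q p' \<rho> where "N < q" and "p' \<in> P q" and "\<rho> = 1 / (4 * real q powr t)"
    and "cball p' \<rho> \<subseteq> cball p r"
    and "hit_weight U (\<lambda>i. d i powr u) (cball p' \<rho> \<inter> F) \<le> (l * \<rho>) powr u"
proof -
  define a where "a = s - t * u"
  have a: "0 < a" using u by (simp add: a_def)
  \<comment> \<open>With \<open>e = 1 / q\<close> and \<open>\<rho> = 1 / (4 * q powr t)\<close>,
    the condition \<open>gain\<close> of the descent reads \<open>X \<le> q powr a\<close>. Since
    \<open>a > 0\<close>, all large \<open>q\<close> satisfy it.\<close>
  define X where "X = 2 * C\<^sup>2 * r powr u * 4 powr u / (r / 4) powr s"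
  have X: "0 < X" using C_pos r by (simp add: X_def)
  obtain q :: nat where q: "max (real N) (max (4 / r) (X powr (1 / a))) < real q"
    using reals_Archimedean2 by blast
  then have q_N: "N < q" and q_r: "4 / r < real q" and q_X: "X powr (1 / a) \<le> real q"
    by auto
  have q1: "1 \<le> real q" using q_N by simp
  \<comment> \<open>The factor 4 secures \<open>4 * \<rho> \<le> 1 / q\<close>, also when
    \<open>t = 1\<close>; the ball still lies inside the one of radius \<open>1 / q powr t\<close>
    that defines the limsup set.\<close>
  define \<rho> where "\<rho> = 1 / (4 * real q powr t)"
  have "real q powr 1 \<le> real q powr t"
    using q1 t by (intro powr_mono) auto
  then have \<rho>: "0 < \<rho>" "4 * \<rho> \<le> 1 / real q"
    using q1 by (auto simp: \<rho>_def divide_simps)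
  have "u \<le> t * u" using mult_right_mono[of 1 t u] t u by simp
  then have u_s: "u \<le> s" using u(2) by linarith
  have "X = (X powr (1 / a)) powr a"
    using a X by (simp add: powr_powr)
  also have "\<dots> \<le> real q powr a"
    using q_X a by (intro powr_mono2) auto
  finally have X_le: "X \<le> real q powr a" .
  have "2 * C\<^sup>2 * r powr u = X * ((r / 4) powr s / 4 powr u)"
    using r by (simp add: X_def)
  also have "\<dots> \<le> real q powr a * ((r / 4) powr s / 4 powr u)"
    by (intro mult_right_mono X_le) auto
  also have "\<dots> = (r / (4 * (1 / real q))) powr s * \<rho> powr u"
    using q1 by (simp add: a_def \<rho>_def powr_diff powr_mult powr_divide powr_powr mult_ac)
  finally have gain: "2 * C\<^sup>2 * r powr u \<le> (r / (4 * (1 / real q))) powr s * \<rho> powr u" .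
  have A: "maximal_separated F (1 / real q) (P q)"
    using P q1 by (simp add: abstract_rationals_def)
  have e: "0 < 1 / real q" "4 * (1 / real q) \<le> r"
    using q1 q_r r by (auto simp: field_simps)
  obtain p' where "p' \<in> P q" "cball p' \<rho> \<subseteq> cball p r"
    "hit_weight U (\<lambda>i. d i powr u) (cball p' \<rho> \<inter> F) \<le> (l * \<rho>) powr u"
    using hit_weight_descent[OF A p e r(2) u(1) u_s l l_small d U sum hit \<rho> gain] by blast
  then show thesis using that q_N \<rho>_def by blast
qed

text \<open>The threshold \<open>k\<close> is the admissible hit weight of an initial ball of radius
  \<open>1 / 2\<close>, hence the same for all covers. The \<open>d i\<close> are positive bounds
  for the diameters rather than the diameters themselves, which may be 0.\<close>

lemma well_approximable_not_covered:
  assumes P: "abstract_rationals F P" and t: "1 \<le> t" and u: "0 < u" "t * u < s"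
    and ne: "F \<noteq> {}"
  obtains k where "0 < k"
    and "\<And>U d. (\<And>i. 0 < d i) \<Longrightarrow> (\<And>i x y. x \<in> U i \<Longrightarrow> y \<in> U i \<Longrightarrow> dist x y \<le> d i) \<Longrightarrow>
      summable (\<lambda>i. d i powr u) \<Longrightarrow> (\<Sum>i. d i powr u) \<le> k \<Longrightarrow>
      \<not> well_approximable F P t \<subseteq> (\<Union>i::nat. U i)"
proof -
  have "0 < t * u" using t u by simp
  then have s: "0 < s" using u by simp
  \<comment> \<open>The second entry solves \<open>C ^ 4 * (48 * l) powr s = 1 / 2\<close>; the
    first gives \<open>4 * l < 1\<close>.\<close>
  define l where "l = min (1 / 5) ((1 / (2 * C ^ 4)) powr (1 / s) / 48)"
  have l: "0 < l" "4 * l < 1" using C_pos by (auto simp: l_def)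
  have "(48 * l) powr s \<le> ((1 / (2 * C ^ 4)) powr (1 / s)) powr s"
    using l s by (intro powr_mono2) (auto simp: l_def)
  also have "\<dots> = 1 / (2 * C ^ 4)"
    using s C_pos by (simp add: powr_powr)
  finally have l_small: "C ^ 4 * (48 * l) powr s \<le> 1 / 2"
    using C_pos by (simp add: field_simps)
  show thesis
  proof (rule that[of "(l * (1 / 2)) powr u"])
    fix U :: "nat \<Rightarrow> 'a set" and d :: "nat \<Rightarrow> real"
    assume d: "\<And>i. 0 < d i" and U: "\<And>i x y. x \<in> U i \<Longrightarrow> y \<in> U i \<Longrightarrow> dist x y \<le> d i"
      and sum: "summable (\<lambda>i. d i powr u)" and total: "(\<Sum>i. d i powr u) \<le> (l * (1 / 2)) powr u"
    let ?W = "\<lambda>p r. hit_weight U (\<lambda>i. d i powr u) (cball p r \<inter> F)"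
    \<comment> \<open>The choice runs over pairs of centre and radius, with invariant
      \<open>?I\<close>. Demanding \<open>q > n\<close> at stage \<open>n\<close> makes the levels
      unbounded and the radii tend to 0.\<close>
    let ?I = "\<lambda>z. fst z \<in> F \<and> 0 < snd z \<and> snd z < 1 \<and> ?W (fst z) (snd z) \<le> (l * snd z) powr u"
    let ?R = "\<lambda>n z z'. \<exists>q>n. fst z' \<in> P q \<and> snd z' = 1 / (4 * real q powr t) \<and>
      cball (fst z') (snd z') \<subseteq> cball (fst z) (snd z)"
    have "\<exists>f. \<forall>n. ?I (f n) \<and> ?R n (f n) (f (Suc n))"
    proof (rule dependent_nat_choice)
      obtain p where "p \<in> F" using ne by blast
      moreover have "?W p (1 / 2) \<le> (l * (1 / 2)) powr u"
        using hit_weight_le_suminf[OF sum, of U "cball p (1 / 2) \<inter> F"] total by simp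
      ultimately show "\<exists>z. ?I z" by (intro exI[of _ "(p, 1 / 2)"]) simp
    next
      fix z n assume z: "?I z"
      obtain q p' \<rho> where q: "n < q" and p': "p' \<in> P q" and \<rho>: "\<rho> = 1 / (4 * real q powr t)"
        and sub: "cball p' \<rho> \<subseteq> cball (fst z) (snd z)" and W: "?W p' \<rho> \<le> (l * \<rho>) powr u"
        using hit_weight_step[where p = "fst z" and r = "snd z" and N = n, OF P t u _ _ _ l l_small d U sum] z
        by blast
      have "P q \<subseteq> F"
        using P q by (simp add: abstract_rationals_def maximal_separated_def)
      then have "p' \<in> F" using p' by blast
      moreover have "real q powr 0 \<le> real q powr t"
        using q t by (intro powr_mono) auto
      then have "0 < \<rho>" "\<rho> < 1" using q by (auto simp: \<rho> divide_simps)
      ultimately show "\<exists>z'. ?I z' \<and> ?R n z z'"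
        using q p' \<rho> sub W by (intro exI[of _ "(p', \<rho>)"]) auto
    qed
    then obtain f where I: "\<And>n. ?I (f n)" and R: "\<And>n. ?R n (f n) (f (Suc n))"
      by blast
    define p r where "p n = fst (f n)" and "r n = snd (f n)" for n
    have p: "p n \<in> F" and r: "0 < r n" "r n < 1" and W: "?W (p n) (r n) \<le> (l * r n) powr u" for n
      using I[of n] by (auto simp: p_def r_def)
    have step: "\<exists>q>n. p (Suc n) \<in> P q \<and> r (Suc n) = 1 / (4 * real q powr t)" for n
      using R[of n] by (auto simp: p_def r_def)
    have "cball (p (Suc n)) (r (Suc n)) \<subseteq> cball (p n) (r n)" for n
      using R[of n] by (auto simp: p_def r_def)
    then have nested: "cball (p n) (r n) \<subseteq> cball (p m) (r m)" if "m \<le> n" for m n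
      using lift_Suc_antimono_le[of "\<lambda>n. cball (p n) (r n)" m n] that by blast
    \<comment> \<open>A limit point of the centres exists by compactness; it lies in every ball,
      because the balls are closed and nested.\<close>
    obtain x k where x: "x \<in> F" and k: "strict_mono k" and lim: "(p \<circ> k) \<longlonglongrightarrow> x"
      using compact_F p unfolding compact_def by meson
    have x_in: "x \<in> cball (p n) (r n)" for n
    proof (rule Lim_in_closed_set[OF closed_cball _ _ lim])
      have "(p \<circ> k) j \<in> cball (p n) (r n)" if "j \<ge> n" for j
      proof -
        have "p (k j) \<in> cball (p (k j)) (r (k j))" using r(1)[of "k j"] by simp
        moreover have "n \<le> k j" using seq_suble[OF k, of j] that by simp
        ultimately have "p (k j) \<in> cball (p n) (r n)" using nested by blast
        then show ?thesis by simp
      qed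
      then show "\<forall>\<^sub>F j in sequentially. (p \<circ> k) j \<in> cball (p n) (r n)"
        by (auto simp: eventually_sequentially)
    qed simp
    have "x \<in> well_approximable F P t"
      unfolding well_approximable_def
    proof (rule INT_I)
      fix n
      obtain q where q: "q > n" "p (Suc n) \<in> P q" "r (Suc n) = 1 / (4 * real q powr t)"
        using step by blast
      have "r (Suc n) \<le> 1 / real q powr t"
        unfolding q(3) using q(1) by (intro divide_left_mono) auto
      then have "x \<in> cball (p (Suc n)) (1 / real q powr t) \<inter> F"
        using x x_in[of "Suc n"] by auto
      then show "x \<in> (\<Union>q\<in>{n<..}. \<Union>p\<in>P q. cball p (1 / real q powr t) \<inter> F)"
        using q by blast
    qed
    \<comment> \<open>Otherwise \<open>U i\<close> would meet all the balls, so
      \<open>d i powr u\<close> would be at most \<open>(l * r n) powr u\<close> for every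
      \<open>n\<close>, while the radii tend to 0.\<close>
    moreover have "x \<notin> U i" for i
    proof
      assume "x \<in> U i"
      obtain n where n: "inverse (real (Suc n)) < d i"
        using reals_Archimedean[OF d] by blast
      obtain q where q: "q > n" "r (Suc n) = 1 / (4 * real q powr t)"
        using step by blast
      have "real (Suc n) \<le> real q powr 1" using q by simp
      also have "\<dots> \<le> real q powr t" using q t by (intro powr_mono) auto
      finally have "real (Suc n) \<le> 4 * real q powr t" by simp
      then have "r (Suc n) \<le> inverse (real (Suc n))"
        unfolding q(2) inverse_eq_divide[symmetric] by (intro le_imp_inverse_le) auto
      then have "l * r (Suc n) < d i"
        using n l r[of "Suc n"] mult_right_mono[of l 1 "r (Suc n)"] by linarith
      then have less: "(l * r (Suc n)) powr u < d i powr u"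
        using l r[of "Suc n"] u by (intro powr_less_mono2) auto
      have "U i \<inter> (cball (p (Suc n)) (r (Suc n)) \<inter> F) \<noteq> {}"
        using \<open>x \<in> U i\<close> x x_in by blast
      then have "d i powr u \<le> ?W (p (Suc n)) (r (Suc n))"
        by (intro weight_le_hit_weight[OF sum]) auto
      then show False using less W[of "Suc n"] by simp
    qed
    ultimately show "\<not> well_approximable F P t \<subseteq> (\<Union>i. U i)" by blast
  qed (use l in simp)
qed

text \<open>A null set has a cover of total weight below \<open>k / 2\<close>. The other half of
  \<open>k\<close> pays for replacing the diameters by positive bounds, and
  \<open>well_approximable_not_covered\<close> is contradicted.\<close>

lemma hausdorff_measure_well_approximable_neq_0:
  assumes P: "abstract_rationals F P" and t: "1 \<le> t" and u: "0 < u" "t * u < s"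
    and ne: "F \<noteq> {}"
  shows "hausdorff_measure u (well_approximable F P t) \<noteq> 0"
proof
  let ?A = "well_approximable F P t"
  assume zero: "hausdorff_measure u ?A = 0"
  obtain k where k: "0 < k"
    and uncovered: "\<And>U d. (\<And>i. 0 < d i) \<Longrightarrow>
      (\<And>i x y. x \<in> U i \<Longrightarrow> y \<in> U i \<Longrightarrow> dist x y \<le> d i) \<Longrightarrow>
      summable (\<lambda>i. d i powr u) \<Longrightarrow> (\<Sum>i. d i powr u) \<le> k \<Longrightarrow> \<not> ?A \<subseteq> (\<Union>i::nat. U i)"
    using well_approximable_not_covered[OF P t u ne] by metis
  have "hausdorff_premeasure u 1 ?A \<le> hausdorff_measure u ?A"
    by (rule hausdorff_premeasure_le_measure) simp
  then have "hausdorff_premeasure u 1 ?A < ennreal (k / 2)"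
    using zero k by simp
  then obtain U where U: "U \<in> delta_covers 1 ?A" and less: "(\<Sum>i. diam_weight u (U i)) < ennreal (k / 2)"
    by (rule hausdorff_premeasure_approx)
  define D where "D i = diameter (U i) powr u" for i
  have D_nonneg: "0 \<le> D i" for i by (simp add: D_def)
  have "diam_weight u (U i) = ennreal (D i)" for i
    using u by (simp add: diam_weight_def D_def)
  then have less': "(\<Sum>i. ennreal (D i)) < ennreal (k / 2)" using less by simp
  then have fin: "(\<Sum>i. ennreal (D i)) \<noteq> top" by auto
  have D_sum: "summable D"
    by (rule summable_suminf_not_top[OF D_nonneg fin])
  have D_le: "suminf D < k / 2"
    using less' D_nonneg fin k by (simp add: ennreal_less_iff suminf_nonneg D_sum)
  \<comment> \<open>Each weight is enlarged a little, since the diameters may vanish.\<close>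
  define w where "w i = D i + k / 2 * (1 / 2) ^ Suc i" for i
  have w_pos: "0 < w i" for i using D_nonneg[of i] k by (simp add: w_def add_nonneg_pos)
  have geo: "(\<lambda>i. k / 2 * (1 / 2) ^ Suc i) sums (k / 2)"
    using sums_mult[OF power_half_series, of "k / 2"] by simp
  have w_sums: "w sums (suminf D + k / 2)"
    unfolding w_def by (rule sums_add[OF summable_sums[OF D_sum] geo])
  \<comment> \<open>Taking the root turns the enlarged weight back into a length, which dominates
    the diameter since \<open>w i \<ge> D i\<close>.\<close>
  define d where "d i = w i powr (1 / u)" for i
  have d_powr: "d i powr u = w i" for i
    using u w_pos[of i] by (simp add: d_def powr_powr)
  have "\<not> ?A \<subseteq> (\<Union>i. U i)"
  proof (rule uncovered)
    show "0 < d i" for i using w_pos[of i] by (simp add: d_def)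
    fix i x y assume xy: "x \<in> U i" "y \<in> U i"
    have "0 \<le> diameter (U i)"
      by (rule diameter_ge_0[OF delta_coversD(2)[OF U]])
    have "dist x y \<le> diameter (U i)"
      using diameter_bounded_bound[OF delta_coversD(2)[OF U]] xy by blast
    also have "\<dots> = D i powr (1 / u)"
      using u \<open>0 \<le> diameter (U i)\<close> by (simp add: D_def powr_powr)
    also have "\<dots> \<le> d i"
      unfolding d_def w_def using u k D_nonneg by (intro powr_mono2) auto
    finally show "dist x y \<le> d i" .
  next
    show "summable (\<lambda>i. d i powr u)"
      using w_sums by (simp add: d_powr sums_iff)
    show "(\<Sum>i. d i powr u) \<le> k"
      using w_sums D_le by (simp add: d_powr sums_iff)
  qed
  then show False using delta_coversD(1)[OF U] by blast
qed

end

section \<open>Exponent zero and the dimension estimates\<close>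

lemma hausdorff_measure_0_eq_0_imp_empty:
  assumes "hausdorff_measure 0 A = 0"
  shows "A = {}"
proof -
  have "hausdorff_premeasure 0 1 A \<le> hausdorff_measure 0 A"
    by (rule hausdorff_premeasure_le_measure) simp
  then have "hausdorff_premeasure 0 1 A < 1" using assms by simp
  then obtain U where U: "U \<in> delta_covers 1 A" and less: "(\<Sum>i. diam_weight 0 (U i)) < 1"
    by (rule hausdorff_premeasure_approx)
  \<comment> \<open>In dimension 0 every nonempty set weighs 1, which exceeds the total.\<close>
  have "U i = {}" for i
  proof (rule ccontr)
    assume "U i \<noteq> {}"
    then have "1 = (\<Sum>j\<in>{i}. diam_weight 0 (U j))" by (simp add: diam_weight_def)
    also have "\<dots> \<le> (\<Sum>j. diam_weight 0 (U j))" by (rule sum_le_suminf) auto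
    finally show False using less by simp
  qed
  then show ?thesis using delta_coversD(1)[OF U] by simp
qed

lemma hausdorff_measure_empty: "hausdorff_measure s {} = 0"
proof -
  have "hausdorff_measure s {} \<le> 0"
    unfolding hausdorff_measure_def by (rule SUP_least) simp
  then show ?thesis by simp
qed

theorem theorem2p7:
  fixes F :: "'a::metric_space set" and P :: "nat \<Rightarrow> 'a set" and s t :: real
  assumes "0 \<le> s"
    and "F \<noteq> {}" and "compact F" and "ahlfors_david_regular s F"
    and "abstract_rationals F P"
    and "1 \<le> t"
  shows "ereal (s / t) \<le> hausdorff_dim (well_approximable F P t) \<and>
         hausdorff_dim (well_approximable F P t) \<le> ereal ((s + 1) / t)"
proof
  let ?A = "well_approximable F P t"
  obtain C where "0 < C" and "\<And>r x. 0 < r \<Longrightarrow> r < 1 \<Longrightarrow> x \<in> F \<Longrightarrow>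
        ennreal (r powr s / C) \<le> hausdorff_measure s (cball x r \<inter> F) \<and>
        hausdorff_measure s (cball x r \<inter> F) \<le> ennreal (C * r powr s)"
    using assms(4) unfolding ahlfors_david_regular_def by blast
  then interpret regular_space F s C
    using assms(1,3) by unfold_locales auto
  have t: "0 < t" using assms(6) by simp
  have pos: "s / t \<le> v" if "0 < v" "hausdorff_measure v ?A = 0" for v
    using hausdorff_measure_well_approximable_neq_0[OF assms(5,6) that(1) _ assms(2)] that(2) t
    by (force simp: field_simps not_le)
  have "s / t \<le> v" if v: "0 \<le> v" "hausdorff_measure v ?A = 0" for v
  proof (cases "v = 0")
    case True
    then have "?A = {}" using v by (simp add: hausdorff_measure_0_eq_0_imp_empty)
    \<comment> \<open>The empty set is null for every exponent, so \<open>pos\<close> applies to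
      half of \<open>s / t\<close>, which is absurd for positive \<open>s\<close>. For
      \<open>s = 0\<close> the goal is 0 \<le> 0.\<close>
    then have "s / t \<le> s / t / 2" if "0 < s"
      using that t by (intro pos) (auto simp: hausdorff_measure_empty)
    then show ?thesis using True assms(1) t by (cases "s = 0") (auto simp: field_simps)
  qed (use v pos in auto)
  then show "ereal (s / t) \<le> hausdorff_dim ?A"
    unfolding hausdorff_dim_def by (auto intro!: Inf_greatest)
  show "hausdorff_dim ?A \<le> ereal ((s + 1) / t)"
  proof (rule ereal_le_epsilon2)
    fix e :: real assume e: "0 < e"
    \<comment> \<open>The summand \<open>e\<close> provides the strict inequality
      \<open>s + 1 < t * ?u\<close> that convergence of the cost series requires.\<close>
    let ?u = "(s + 1) / t + e"
    have "s + 1 < t * ?u" using t e by (simp add: field_simps)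
    then have "hausdorff_measure ?u ?A = 0"
      by (rule hausdorff_measure_well_approximable_eq_0[OF assms(5,6)])
    moreover have "0 \<le> ?u" using assms(1) t e by simp
    ultimately have "hausdorff_dim ?A \<le> ereal ?u"
      unfolding hausdorff_dim_def by (intro Inf_lower) blast
    then show "hausdorff_dim ?A \<le> ereal ((s + 1) / t) + ereal e" by simp
  qed
qed

end
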